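(* For each $N\ge1$ let $J_N$ be a real symmetric $N\times N$ matrix with zero diagonal, with $\sup_{N\ge1}\|J_N\|<\infty$, and let $\beta_0>0$ be fixed. Suppose $$\limsup_{N\to\infty}F_N(\beta_0)<\infty.$$ Then for all $0\le\beta_1<\beta_2\le\beta_0$ there exists no consistent sequence of tests for the testing problem $H_0:\beta=\beta_1$ versus $H_1:\beta=\beta_2$ based on a single observation $\sigma\sim\mathbb P_\beta$. In particular, there exists no consistent sequence of estimators for $\beta$ in the interval $[0,\beta_0]$, i.e. no sequence of functions $\hat\beta_N:S_N\to\mathbb{R}$ such that for every $\beta\in[0,\beta_0]$, $\hat\beta_N(\sigma)\to\beta$ in probability under $\sigma\sim\mathbb{P}_\beta$.
   Context: Let $S_N=\{-1,1\}^N$ and $\|J_N\|$ the ($\ell_2$) operator norm. For $\tau\in S_N$ put $H_N(\tau)=\tau'J_N\tau=\sum_{i,j}J_N(i,j)\tau_i\tau_j$. For $\beta\ge0$, $\mathbb P_\beta$ is the probability measure on $S_N$ with $$\mathbb{P}_\beta(\sigma=\tau)=2^{-N}\exp\{\tfrac12\beta H_N(\tau)-F_N(\beta)\},\qquad F_N(\beta)=\log\Big\{2^{-N}\sum_{\tau\in S_N}e^{\frac12\beta H_N(\tau)}\Big\},$$ and $\mathbb E_\beta$ is the expectation under $\mathbb P_\beta$. A sequence of test functions $\phi_N:S_N\to\{0,1\}$ is consistent for testing $\beta=\beta_1$ versus $\beta=\beta_2$ if $\lim_{N\to\infty}\mathbb{E}_{\beta_1}\phi_N=0$ and $\lim_{N\to\infty}\mathbb{E}_{\beta_2}\phi_N=1$.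 *)

theory Defs
  imports "HOL-Probability.Probability"
begin

text \<open>
  The matrix with index range \<open>{1..N}\<close> is a function \<open>A :: nat \<Rightarrow> nat \<Rightarrow> real\<close> of which only the
  entries with both indices in \<open>{1..N}\<close> are relevant; likewise for vectors. A sequence of matrices
  \<open>J\<close> is indexed as \<open>J N i j\<close>.
\<close>

definition symmetric_matrix :: "nat \<Rightarrow> (nat \<Rightarrow> nat \<Rightarrow> real) \<Rightarrow> bool" where
  "symmetric_matrix N A \<longleftrightarrow> (\<forall>i\<in>{1..N}. \<forall>j\<in>{1..N}. A i j = A j i)"

definition zero_diagonal :: "nat \<Rightarrow> (nat \<Rightarrow> nat \<Rightarrow> real) \<Rightarrow> bool" where
  "zero_diagonal N A \<longleftrightarrow> (\<forall>i\<in>{1..N}. A i i = 0)"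

text \<open>
  The \<open>\<ell>\<^sub>2\<close> operator norm, of the same form as \<^const>\<open>onorm\<close> (whose dimension would be fixed by a
  type). A vector whose restriction to \<open>{1..N}\<close> vanishes contributes \<open>0 / 0 = 0\<close>.
\<close>

definition op_norm :: "nat \<Rightarrow> (nat \<Rightarrow> nat \<Rightarrow> real) \<Rightarrow> real" where
  "op_norm N A = (SUP x. L2_set (\<lambda>i. \<Sum>j=1..N. A i j * x j) {1..N} / L2_set x {1..N})"

lemma op_norm_bdd_above:
  fixes A :: "nat \<Rightarrow> nat \<Rightarrow> real"
  shows "bdd_above (range (\<lambda>x. L2_set (\<lambda>i. \<Sum>j=1..N. A i j * x j) {1..N} / L2_set x {1..N}))"
proof (rule bdd_aboveI2)
  fix x :: "nat \<Rightarrow> real"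
  let ?C = "L2_set (\<lambda>i. L2_set (A i) {1..N}) {1..N}"
  have row: "\<bar>\<Sum>j=1..N. A i j * x j\<bar> \<le> L2_set (A i) {1..N} * L2_set x {1..N}" for i
  proof -
    have "\<bar>\<Sum>j=1..N. A i j * x j\<bar> \<le> (\<Sum>j=1..N. \<bar>A i j\<bar> * \<bar>x j\<bar>)"
      by (rule order_trans[OF sum_abs]) (simp add: abs_mult)
    also have "\<dots> \<le> L2_set (A i) {1..N} * L2_set x {1..N}"
      by (rule L2_set_mult_ineq)
    finally show ?thesis .
  qed
  have "L2_set (\<lambda>i. \<Sum>j=1..N. A i j * x j) {1..N}
      = L2_set (\<lambda>i. \<bar>\<Sum>j=1..N. A i j * x j\<bar>) {1..N}"
    by (simp add: L2_set_def)
  also have "\<dots> \<le> L2_set (\<lambda>i. L2_set (A i) {1..N} * L2_set x {1..N}) {1..N}"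
    by (rule L2_set_mono) (use row in auto)
  also have "\<dots> = ?C * L2_set x {1..N}"
    by (simp add: L2_set_left_distrib)
  finally show "L2_set (\<lambda>i. \<Sum>j=1..N. A i j * x j) {1..N} / L2_set x {1..N} \<le> ?C"
    by (cases "L2_set x {1..N} = 0") (auto simp: divide_le_eq less_le)
qed

definition spins :: "nat \<Rightarrow> (nat \<Rightarrow> real) set" where
  "spins N = {1..N} \<rightarrow>\<^sub>E {-1, 1}"

definition hamiltonian :: "(nat \<Rightarrow> nat \<Rightarrow> nat \<Rightarrow> real) \<Rightarrow> nat \<Rightarrow> (nat \<Rightarrow> real) \<Rightarrow> real" where
  "hamiltonian J N \<tau> = (\<Sum>i=1..N. \<Sum>j=1..N. J N i j * \<tau> i * \<tau> j)"

definition log_partition :: "(nat \<Rightarrow> nat \<Rightarrow> nat \<Rightarrow> real) \<Rightarrow> nat \<Rightarrow> real \<Rightarrow> real" where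
  "log_partition J N \<beta> =
     ln (1 / 2 ^ N * (\<Sum>\<tau>\<in>spins N. exp (1 / 2 * \<beta> * hamiltonian J N \<tau>)))"

definition gibbs :: "(nat \<Rightarrow> nat \<Rightarrow> nat \<Rightarrow> real) \<Rightarrow> nat \<Rightarrow> real \<Rightarrow> (nat \<Rightarrow> real) measure" where
  "gibbs J N \<beta> = point_measure (spins N)
     (\<lambda>\<tau>. ennreal (1 / 2 ^ N * exp (1 / 2 * \<beta> * hamiltonian J N \<tau> - log_partition J N \<beta>)))"

lemma finite_spins: "finite (spins N)"
  by (simp add: spins_def finite_PiE)

lemma spins_nonempty: "spins N \<noteq> {}"
  by (simp add: spins_def PiE_eq_empty_iff)

lemma prob_space_gibbs: "prob_space (gibbs J N \<beta>)"
proof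
  let ?Z = "\<Sum>\<tau>\<in>spins N. exp (1 / 2 * \<beta> * hamiltonian J N \<tau>)"
  have pos: "?Z > 0"
    by (intro sum_pos finite_spins spins_nonempty) simp
  have "(\<Sum>\<tau>\<in>spins N. 1 / 2 ^ N * exp (1 / 2 * \<beta> * hamiltonian J N \<tau> - log_partition J N \<beta>))
      = 1 / 2 ^ N * ?Z / exp (log_partition J N \<beta>)"
    by (simp add: exp_diff sum_divide_distrib)
  also have "exp (log_partition J N \<beta>) = 1 / 2 ^ N * ?Z"
    unfolding log_partition_def using pos by (subst exp_ln) auto
  finally have one:
    "(\<Sum>\<tau>\<in>spins N. 1 / 2 ^ N * exp (1 / 2 * \<beta> * hamiltonian J N \<tau> - log_partition J N \<beta>)) = 1"
    using pos by simp
  show "emeasure (gibbs J N \<beta>) (space (gibbs J N \<beta>)) = 1"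
    unfolding gibbs_def space_point_measure
    by (subst emeasure_point_measure_finite[OF finite_spins order_refl],
        subst sum_ennreal) (auto simp: one[simplified])
qed

definition consistent_tests ::
  "(nat \<Rightarrow> nat \<Rightarrow> nat \<Rightarrow> real) \<Rightarrow> real \<Rightarrow> real \<Rightarrow> (nat \<Rightarrow> (nat \<Rightarrow> real) \<Rightarrow> real) \<Rightarrow> bool" where
  "consistent_tests J \<beta>\<^sub>1 \<beta>\<^sub>2 \<phi> \<longleftrightarrow>
     (\<forall>N\<ge>1. \<phi> N \<in> spins N \<rightarrow> {0, 1}) \<and>
     (\<lambda>N. integral\<^sup>L (gibbs J N \<beta>\<^sub>1) (\<phi> N)) \<longlonglongrightarrow> 0 \<and>
     (\<lambda>N. integral\<^sup>L (gibbs J N \<beta>\<^sub>2) (\<phi> N)) \<longlonglongrightarrow> 1"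

definition tendsto_in_gibbs_probability ::
  "(nat \<Rightarrow> nat \<Rightarrow> nat \<Rightarrow> real) \<Rightarrow> real \<Rightarrow> (nat \<Rightarrow> (nat \<Rightarrow> real) \<Rightarrow> real) \<Rightarrow> real \<Rightarrow> bool" where
  "tendsto_in_gibbs_probability J \<beta> X c \<longleftrightarrow>
     (\<forall>\<epsilon>>0. (\<lambda>N. measure (gibbs J N \<beta>) {\<sigma> \<in> spins N. \<bar>X N \<sigma> - c\<bar> > \<epsilon>}) \<longlonglongrightarrow> 0)"

definition consistent_estimators ::
  "(nat \<Rightarrow> nat \<Rightarrow> nat \<Rightarrow> real) \<Rightarrow> real set \<Rightarrow> (nat \<Rightarrow> (nat \<Rightarrow> real) \<Rightarrow> real) \<Rightarrow> bool" where
  "consistent_estimators J B est \<longleftrightarrow>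
     (\<forall>\<beta>\<in>B. tendsto_in_gibbs_probability J \<beta> est \<beta>)"

end

theory Submission
  imports Defs
begin

text \<open>
  The Hellinger affinity \<open>\<Sum>\<tau>. sqrt (\<P>\<^sub>1 \<tau> * \<P>\<^sub>2 \<tau>)\<close> of the Gibbs measures at \<open>\<beta>\<^sub>1\<close> and \<open>\<beta>\<^sub>2\<close> equals
  \<open>exp (F ((\<beta>\<^sub>1 + \<beta>\<^sub>2) / 2) - (F \<beta>\<^sub>1 + F \<beta>\<^sub>2) / 2)\<close>. Because \<open>H\<close> has mean zero under the uniform
  measure, \<open>F\<close> is nonnegative and, on \<open>[0, \<beta>\<^sub>0]\<close>, at most \<open>F \<beta>\<^sub>0\<close>. So the affinity stays bounded
  away from zero, whereas by Cauchy--Schwarz a consistent sequence of tests would force it to vanish.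
  Thresholding a consistent estimator at \<open>\<beta>\<^sub>0 / 2\<close> would give a consistent test of \<open>0\<close> versus \<open>\<beta>\<^sub>0\<close>.
\<close>

text \<open>Split the sum into \<open>f = 1\<close> and \<open>f = 0\<close> and apply
  Cauchy-Schwarz to each part. In each, one factor is enlarged to full mass 1, leaving the square
  root of the error of first kind (under \<open>p\<close>) or of second kind (under
  \<open>q\<close>).\<close>

lemma affinity_le_test_errors:
  fixes p q f :: "'a \<Rightarrow> real"
  assumes "\<And>x. x \<in> A \<Longrightarrow> 0 \<le> p x" and "\<And>x. x \<in> A \<Longrightarrow> 0 \<le> q x"
    and "sum p A = 1" and "sum q A = 1" and f: "f \<in> A \<rightarrow> {0, 1}"
  shows "(\<Sum>x\<in>A. sqrt (p x * q x)) \<le> sqrt (\<Sum>x\<in>A. p x * f x) + sqrt (1 - (\<Sum>x\<in>A. q x * f x))"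
proof -
  have f01: "f x = 0 \<or> f x = 1" if "x \<in> A" for x
    using f that by auto
  have L2: "L2_set (\<lambda>x. sqrt (g x)) A = sqrt (sum g A)" if "\<And>x. x \<in> A \<Longrightarrow> 0 \<le> g x" for g
    unfolding L2_set_def using that by (intro arg_cong[where f = sqrt] sum.cong) auto
  \<comment> \<open>Since \<open>f x\<close> is 0 or 1, one of the two summands is
    \<open>sqrt (p x * q x)\<close> and the other vanishes. The absolute values fit the form of
    \<open>L2_set_mult_ineq\<close>.\<close>
  have "(\<Sum>x\<in>A. sqrt (p x * q x))
      = (\<Sum>x\<in>A. \<bar>sqrt (p x * f x)\<bar> * \<bar>sqrt (q x)\<bar>)
        + (\<Sum>x\<in>A. \<bar>sqrt (p x)\<bar> * \<bar>sqrt (q x * (1 - f x))\<bar>)"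
    unfolding sum.distrib[symmetric]
    by (intro sum.cong refl) (use f01 assms(1,2) in \<open>force simp: real_sqrt_mult\<close>)
  also have "\<dots> \<le> L2_set (\<lambda>x. sqrt (p x * f x)) A * L2_set (\<lambda>x. sqrt (q x)) A
      + L2_set (\<lambda>x. sqrt (p x)) A * L2_set (\<lambda>x. sqrt (q x * (1 - f x))) A"
    by (intro add_mono L2_set_mult_ineq)
  also have "\<dots> = sqrt (\<Sum>x\<in>A. p x * f x) + sqrt (\<Sum>x\<in>A. q x * (1 - f x))"
    using f01 assms(1-4) by (subst (1 2 3 4) L2) (force intro!: mult_nonneg_nonneg)+
  also have "(\<Sum>x\<in>A. q x * (1 - f x)) = 1 - (\<Sum>x\<in>A. q x * f x)"
    using assms(4) by (simp add: algebra_simps sum_subtractf)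
  finally show ?thesis .
qed

lemma spins_at: "\<tau> \<in> spins N \<Longrightarrow> i \<in> {1..N} \<Longrightarrow> \<tau> i = -1 \<or> \<tau> i = 1"
  by (auto simp: spins_def PiE_def Pi_def)

lemma card_spins: "card (spins N) = 2 ^ N"
  by (simp add: spins_def card_PiE numeral_2_eq_2)

text \<open>Flipping the spin at \<open>i\<close> is an involution of the cube that negates the
  product, because \<open>\<tau> j\<close> stays put.\<close>

lemma sum_spins_product:
  assumes "i \<in> {1..N}" and "i \<noteq> j"
  shows "(\<Sum>\<tau>\<in>spins N. \<tau> i * \<tau> j) = 0"
proof -
  have flip: "\<tau>(i := - \<tau> i) \<in> spins N" if "\<tau> \<in> spins N" for \<tau>
    using that spins_at[OF that assms(1)] assms(1)
    by (auto simp: spins_def PiE_def Pi_def extensional_def)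
  have "(\<Sum>\<tau>\<in>spins N. \<tau> i * \<tau> j) = (\<Sum>\<tau>\<in>spins N. - (\<tau> i * \<tau> j))"
    by (rule sum.reindex_bij_witness[where i = "\<lambda>\<tau>. \<tau>(i := - \<tau> i)" and j = "\<lambda>\<tau>. \<tau>(i := - \<tau> i)"])
       (use flip assms(2) in auto)
  then show ?thesis
    by (simp add: sum_negf)
qed

text \<open>Off-diagonal terms cancel by the spin flip; the diagonal terms, which would contribute a
  multiple of the trace, are zero.\<close>

lemma sum_hamiltonian:
  assumes "zero_diagonal N (J N)"
  shows "(\<Sum>\<tau>\<in>spins N. hamiltonian J N \<tau>) = 0"
proof -
  have "(\<Sum>\<tau>\<in>spins N. hamiltonian J N \<tau>)
      = (\<Sum>i=1..N. \<Sum>\<tau>\<in>spins N. \<Sum>j=1..N. J N i j * \<tau> i * \<tau> j)"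
    unfolding hamiltonian_def by (rule sum.swap)
  also have "\<dots> = (\<Sum>i=1..N. \<Sum>j=1..N. \<Sum>\<tau>\<in>spins N. J N i j * \<tau> i * \<tau> j)"
    by (intro sum.cong refl sum.swap)
  also have "\<dots> = (\<Sum>i=1..N. \<Sum>j=1..N. J N i j * (\<Sum>\<tau>\<in>spins N. \<tau> i * \<tau> j))"
    by (simp add: sum_distrib_left mult.assoc)
  also have "\<dots> = 0"
  proof (intro sum.neutral ballI)
    fix i j assume "i \<in> {1..N}" "j \<in> {1..N}"
    then show "J N i j * (\<Sum>\<tau>\<in>spins N. \<tau> i * \<tau> j) = 0"
      using assms sum_spins_product[of i N j] by (cases "i = j") (auto simp: zero_diagonal_def)
  qed
  finally show ?thesis .
qed

lemma exp_log_partition: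
  "exp (log_partition J N \<beta>) = 1 / 2 ^ N * (\<Sum>\<tau>\<in>spins N. exp (1 / 2 * \<beta> * hamiltonian J N \<tau>))"
proof -
  have "(\<Sum>\<tau>\<in>spins N. exp (1 / 2 * \<beta> * hamiltonian J N \<tau>)) > 0"
    by (intro sum_pos finite_spins spins_nonempty) simp
  then show ?thesis
    unfolding log_partition_def by (subst exp_ln) auto
qed

text \<open>Jensen's inequality in the form \<open>exp x \<ge> 1 + x\<close>: the linear term sums
  to zero, so the average of the exponentials is at least 1. The sign of \<beta> is
  arbitrary.\<close>

lemma log_partition_nonneg:
  assumes "zero_diagonal N (J N)"
  shows "0 \<le> log_partition J N \<beta>"
proof -
  have "2 ^ N = (\<Sum>\<tau>\<in>spins N. 1 + 1 / 2 * \<beta> * hamiltonian J N \<tau>)"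
    using sum_hamiltonian[of N J, OF assms]
    by (simp only: sum.distrib sum_distrib_left[symmetric]) (simp add: card_spins)
  also have "\<dots> \<le> (\<Sum>\<tau>\<in>spins N. exp (1 / 2 * \<beta> * hamiltonian J N \<tau>))"
    by (intro sum_mono exp_ge_add_one_self)
  finally have "1 \<le> exp (log_partition J N \<beta>)"
    unfolding exp_log_partition by simp
  then show ?thesis
    by simp
qed

text \<open>By convexity of \<open>exp\<close>, the normalised partition function lies below its
  chord between 0, where it is 1, and \<open>\<beta>\<^sub>0\<close>, where it is at least
  1.\<close>

lemma log_partition_le:
  assumes "zero_diagonal N (J N)" and "0 \<le> \<beta>" and "\<beta> \<le> \<beta>\<^sub>0" and "0 < \<beta>\<^sub>0"
  shows "log_partition J N \<beta> \<le> log_partition J N \<beta>\<^sub>0"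
proof -
  define t where "t = \<beta> / \<beta>\<^sub>0"
  have t: "0 \<le> t" "t \<le> 1" "t * \<beta>\<^sub>0 = \<beta>"
    using assms(2-4) by (auto simp: t_def)
  have conv: "exp (t * x) \<le> (1 - t) + t * exp x" for x :: real
    using convex_onD[OF exp_convex, of t 0 x] t by simp
  have "(\<Sum>\<tau>\<in>spins N. exp (1 / 2 * \<beta> * hamiltonian J N \<tau>))
      \<le> (\<Sum>\<tau>\<in>spins N. (1 - t) + t * exp (1 / 2 * \<beta>\<^sub>0 * hamiltonian J N \<tau>))"
  proof (rule sum_mono)
    fix \<tau>
    show "exp (1 / 2 * \<beta> * hamiltonian J N \<tau>) \<le> (1 - t) + t * exp (1 / 2 * \<beta>\<^sub>0 * hamiltonian J N \<tau>)"
      using conv[of "1 / 2 * \<beta>\<^sub>0 * hamiltonian J N \<tau>"] by (simp add: t(3)[symmetric] mult_ac)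
  qed
  also have "\<dots> = 2 ^ N * (1 - t) + t * (\<Sum>\<tau>\<in>spins N. exp (1 / 2 * \<beta>\<^sub>0 * hamiltonian J N \<tau>))"
    by (simp only: sum.distrib sum_distrib_left[symmetric]) (simp add: card_spins)
  finally have "exp (log_partition J N \<beta>) \<le> (1 - t) + t * exp (log_partition J N \<beta>\<^sub>0)"
    unfolding exp_log_partition by (simp add: field_simps)
  \<comment> \<open>Nonnegativity of the log-partition function at \<open>\<beta>\<^sub>0\<close>
    replaces the 1 multiplying \<open>1 - t\<close>.\<close>
  also have "\<dots> \<le> (1 - t) * exp (log_partition J N \<beta>\<^sub>0) + t * exp (log_partition J N \<beta>\<^sub>0)"
    using log_partition_nonneg[of N J \<beta>\<^sub>0, OF assms(1)] t by (simp add: mult_le_cancel_left1)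
  also have "\<dots> = exp (log_partition J N \<beta>\<^sub>0)"
    by (simp add: algebra_simps)
  finally show ?thesis
    by simp
qed

definition gibbs_density :: "(nat \<Rightarrow> nat \<Rightarrow> nat \<Rightarrow> real) \<Rightarrow> nat \<Rightarrow> real \<Rightarrow> (nat \<Rightarrow> real) \<Rightarrow> real" where
  "gibbs_density J N \<beta> \<tau> = 1 / 2 ^ N * exp (1 / 2 * \<beta> * hamiltonian J N \<tau> - log_partition J N \<beta>)"

lemma gibbs_density_nonneg: "0 \<le> gibbs_density J N \<beta> \<tau>"
  by (simp add: gibbs_density_def)

lemma sum_gibbs_density: "(\<Sum>\<tau>\<in>spins N. gibbs_density J N \<beta> \<tau>) = 1"
proof -
  have "(\<Sum>\<tau>\<in>spins N. gibbs_density J N \<beta> \<tau>)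
      = 1 / 2 ^ N * (\<Sum>\<tau>\<in>spins N. exp (1 / 2 * \<beta> * hamiltonian J N \<tau>)) / exp (log_partition J N \<beta>)"
    by (simp add: gibbs_density_def exp_diff sum_divide_distrib)
  then show ?thesis
    unfolding exp_log_partition[symmetric] by simp
qed

lemma integral_gibbs:
  fixes f :: "(nat \<Rightarrow> real) \<Rightarrow> real"
  shows "integral\<^sup>L (gibbs J N \<beta>) f = (\<Sum>\<tau>\<in>spins N. gibbs_density J N \<beta> \<tau> * f \<tau>)"
  unfolding gibbs_def gibbs_density_def
  by (subst lebesgue_integral_point_measure_finite[OF finite_spins]) auto

text \<open>Links convergence in probability, stated with \<open>measure\<close>, to tests, stated
  with expectations.\<close>

lemma measure_gibbs:
  "measure (gibbs J N \<beta>) {\<sigma> \<in> spins N. P \<sigma>} = integral\<^sup>L (gibbs J N \<beta>) (\<lambda>\<sigma>. of_bool (P \<sigma>))"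
proof -
  have "measure (gibbs J N \<beta>) {\<sigma> \<in> spins N. P \<sigma>}
      = integral\<^sup>L (gibbs J N \<beta>) (indicator {\<sigma> \<in> spins N. P \<sigma>})"
    by (simp add: gibbs_def space_point_measure Int_absorb1 Int_absorb2)
  also have "\<dots> = integral\<^sup>L (gibbs J N \<beta>) (\<lambda>\<sigma>. of_bool (P \<sigma>))"
    by (rule Bochner_Integration.integral_cong)
       (auto simp: gibbs_def space_point_measure indicator_def)
  finally show ?thesis .
qed

text \<open>The geometric mean of two weights of an exponential family is, up to normalisation, the
  weight at the midpoint parameter, so the sum is a partition function there.\<close>

lemma gibbs_affinity:
  "(\<Sum>\<tau>\<in>spins N. sqrt (gibbs_density J N \<beta>\<^sub>1 \<tau> * gibbs_density J N \<beta>\<^sub>2 \<tau>))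
     = exp (log_partition J N ((\<beta>\<^sub>1 + \<beta>\<^sub>2) / 2)
         - (log_partition J N \<beta>\<^sub>1 + log_partition J N \<beta>\<^sub>2) / 2)"
proof -
  let ?c = "(log_partition J N \<beta>\<^sub>1 + log_partition J N \<beta>\<^sub>2) / 2"
  have "sqrt (gibbs_density J N \<beta>\<^sub>1 \<tau> * gibbs_density J N \<beta>\<^sub>2 \<tau>)
      = 1 / 2 ^ N * exp (1 / 2 * ((\<beta>\<^sub>1 + \<beta>\<^sub>2) / 2) * hamiltonian J N \<tau>) / exp ?c" (is "_ = ?r") for \<tau>
  proof (rule real_sqrt_unique)
    show "?r\<^sup>2 = gibbs_density J N \<beta>\<^sub>1 \<tau> * gibbs_density J N \<beta>\<^sub>2 \<tau>"
      by (simp add: gibbs_density_def power2_eq_square exp_diff[symmetric] exp_add[symmetric]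
            field_simps)
  qed simp
  then show ?thesis
    by (simp only: exp_diff exp_log_partition sum_distrib_left[symmetric] sum_divide_distrib[symmetric])
qed

lemma no_consistent_tests:
  assumes diag: "\<And>N. N \<ge> 1 \<Longrightarrow> zero_diagonal N (J N)"
    and "0 < \<beta>\<^sub>0" and "limsup (\<lambda>N. ereal (log_partition J N \<beta>\<^sub>0)) < \<infinity>"
    and b1: "0 \<le> \<beta>\<^sub>1" "\<beta>\<^sub>1 \<le> \<beta>\<^sub>0" and b2: "0 \<le> \<beta>\<^sub>2" "\<beta>\<^sub>2 \<le> \<beta>\<^sub>0"
  shows "\<not> consistent_tests J \<beta>\<^sub>1 \<beta>\<^sub>2 \<phi>"
proof
  assume cons: "consistent_tests J \<beta>\<^sub>1 \<beta>\<^sub>2 \<phi>"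
  define E where "E \<beta> N = integral\<^sup>L (gibbs J N \<beta>) (\<phi> N)" for \<beta> N
  \<comment> \<open>Any real strictly above the limsup; it bounds the log-partition function at
    \<open>\<beta>\<^sub>0\<close> for all large \<open>N\<close> only.\<close>
  obtain C :: real where "limsup (\<lambda>N. ereal (log_partition J N \<beta>\<^sub>0)) < ereal C"
    using assms(3) by (metis ereal_dense2)
  then have "eventually (\<lambda>N. ereal (log_partition J N \<beta>\<^sub>0) < ereal C) sequentially"
    by (rule Limsup_lessD)
  then have bound: "eventually (\<lambda>N. exp (- C) \<le> sqrt (E \<beta>\<^sub>1 N) + sqrt (1 - E \<beta>\<^sub>2 N)) sequentially"
    using eventually_ge_at_top[of 1]
  proof eventually_elim
    case (elim N)
    note d = diag[OF elim(2)]
    \<comment> \<open>The midpoint term is at least 0, and both subtracted terms are at most the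
      value at \<open>\<beta>\<^sub>0\<close>, hence below \<open>C\<close>.\<close>
    have "exp (- C) \<le> exp (log_partition J N ((\<beta>\<^sub>1 + \<beta>\<^sub>2) / 2)
        - (log_partition J N \<beta>\<^sub>1 + log_partition J N \<beta>\<^sub>2) / 2)"
      using elim(1) log_partition_nonneg[of N J "(\<beta>\<^sub>1 + \<beta>\<^sub>2) / 2", OF d]
        log_partition_le[of N J, OF d b1 assms(2)] log_partition_le[of N J, OF d b2 assms(2)]
      unfolding exp_le_cancel_iff less_ereal.simps by argo
    also have "\<dots> \<le> sqrt (E \<beta>\<^sub>1 N) + sqrt (1 - E \<beta>\<^sub>2 N)"
      unfolding gibbs_affinity[symmetric] E_def integral_gibbs
      using cons elim(2)
      by (intro affinity_le_test_errors gibbs_density_nonneg sum_gibbs_density)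
         (auto simp: consistent_tests_def)
    finally show ?case .
  qed
  have "E \<beta>\<^sub>1 \<longlonglongrightarrow> 0" "E \<beta>\<^sub>2 \<longlonglongrightarrow> 1"
    using cons by (simp_all add: consistent_tests_def E_def[abs_def])
  then have "(\<lambda>N. sqrt (E \<beta>\<^sub>1 N) + sqrt (1 - E \<beta>\<^sub>2 N)) \<longlonglongrightarrow> sqrt 0 + sqrt (1 - 1)"
    by (intro tendsto_intros)
  \<comment> \<open>The eventual bound passes to the limit, where the right side is 0 although
    \<open>exp (- C)\<close> is positive.\<close>
  then have "exp (- C) \<le> sqrt 0 + sqrt (1 - 1)"
    using bound by (rule tendsto_lowerbound) simp
  then show False
    by (simp add: not_le[symmetric])
qed

text \<open>Either error of the midpoint test forces the estimator to miss the true parameter by at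
  least half the gap, which has vanishing probability.\<close>

lemma consistent_tests_of_estimators:
  assumes "\<beta>\<^sub>1 < \<beta>\<^sub>2" and "\<beta>\<^sub>1 \<in> B" and "\<beta>\<^sub>2 \<in> B" and "consistent_estimators J B est"
  shows "consistent_tests J \<beta>\<^sub>1 \<beta>\<^sub>2 (\<lambda>N \<sigma>. of_bool (est N \<sigma> > (\<beta>\<^sub>1 + \<beta>\<^sub>2) / 2))"
proof -
  \<comment> \<open>A quarter of the gap, not half: under \<open>\<beta>\<^sub>2\<close> the test
    also errs when the estimate equals the midpoint, and the deviation must still exceed \<epsilon>
    strictly.\<close>
  define \<epsilon> where "\<epsilon> = (\<beta>\<^sub>2 - \<beta>\<^sub>1) / 4"
  have "\<epsilon> > 0"
    using assms(1) by (simp add: \<epsilon>_def)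
  define E where "E \<beta> N P = integral\<^sup>L (gibbs J N \<beta>) (\<lambda>\<sigma>. of_bool (P \<sigma>) :: real)" for \<beta> N P
  have mono: "E \<beta> N P \<le> E \<beta> N Q" if "\<And>\<sigma>. P \<sigma> \<Longrightarrow> Q \<sigma>" for \<beta> N and P Q :: "_ \<Rightarrow> bool"
    unfolding E_def integral_gibbs
    by (intro sum_mono mult_left_mono gibbs_density_nonneg) (use that in auto)
  have nonneg: "0 \<le> E \<beta> N P" for \<beta> N P
    unfolding E_def by (rule Bochner_Integration.integral_nonneg) simp
  \<comment> \<open>Turns the limit 1 required under \<open>\<beta>\<^sub>2\<close> into a limit 0
    for the complementary event, within reach of the sandwich argument.\<close>
  have compl: "E \<beta> N P = 1 - E \<beta> N (\<lambda>\<sigma>. \<not> P \<sigma>)" for \<beta> N P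
    unfolding E_def integral_gibbs sum_gibbs_density[of J N \<beta>, symmetric] sum_subtractf[symmetric]
    by (intro sum.cong) auto
  have lim: "(\<lambda>N. E \<beta> N (\<lambda>\<sigma>. \<bar>est N \<sigma> - \<beta>\<bar> > \<epsilon>)) \<longlonglongrightarrow> 0" if "\<beta> \<in> B" for \<beta>
    using assms(4) that \<open>\<epsilon> > 0\<close>
    by (simp add: consistent_estimators_def tendsto_in_gibbs_probability_def E_def measure_gibbs)
  have "(\<lambda>N. E \<beta>\<^sub>1 N (\<lambda>\<sigma>. est N \<sigma> > (\<beta>\<^sub>1 + \<beta>\<^sub>2) / 2)) \<longlonglongrightarrow> 0"
    by (rule tendsto_sandwich[OF _ _ tendsto_const lim[OF assms(2)]])
       (use assms(1) in \<open>auto intro!: always_eventually nonneg mono simp: \<epsilon>_def field_simps\<close>)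
  moreover have "(\<lambda>N. E \<beta>\<^sub>2 N (\<lambda>\<sigma>. \<not> est N \<sigma> > (\<beta>\<^sub>1 + \<beta>\<^sub>2) / 2)) \<longlonglongrightarrow> 0"
    by (rule tendsto_sandwich[OF _ _ tendsto_const lim[OF assms(3)]])
       (use assms(1) in \<open>auto intro!: always_eventually nonneg mono simp: \<epsilon>_def field_simps\<close>)
  then have "(\<lambda>N. 1 - E \<beta>\<^sub>2 N (\<lambda>\<sigma>. \<not> est N \<sigma> > (\<beta>\<^sub>1 + \<beta>\<^sub>2) / 2)) \<longlonglongrightarrow> 1 - 0"
    by (intro tendsto_diff tendsto_const)
  then have "(\<lambda>N. E \<beta>\<^sub>2 N (\<lambda>\<sigma>. est N \<sigma> > (\<beta>\<^sub>1 + \<beta>\<^sub>2) / 2)) \<longlonglongrightarrow> 1"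
    unfolding compl[symmetric] by simp
  ultimately show ?thesis
    by (auto simp: consistent_tests_def E_def)
qed

theorem theorem2p3:
  fixes J :: "nat \<Rightarrow> nat \<Rightarrow> nat \<Rightarrow> real" and \<beta>\<^sub>0 :: real
  assumes "\<And>N. N \<ge> 1 \<Longrightarrow> symmetric_matrix N (J N)"
    and "\<And>N. N \<ge> 1 \<Longrightarrow> zero_diagonal N (J N)"
    and "bdd_above ((\<lambda>N. op_norm N (J N)) ` {1..})"
    and "\<beta>\<^sub>0 > 0"
    and "limsup (\<lambda>N. ereal (log_partition J N \<beta>\<^sub>0)) < \<infinity>"
  shows "(\<forall>\<beta>\<^sub>1 \<beta>\<^sub>2. 0 \<le> \<beta>\<^sub>1 \<and> \<beta>\<^sub>1 < \<beta>\<^sub>2 \<and> \<beta>\<^sub>2 \<le> \<beta>\<^sub>0 \<longrightarrow> \<not> (\<exists>\<phi>. consistent_tests J \<beta>\<^sub>1 \<beta>\<^sub>2 \<phi>))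
       \<and> \<not> (\<exists>est. consistent_estimators J {0..\<beta>\<^sub>0} est)"
proof -
  have tests: "\<not> consistent_tests J \<beta>\<^sub>1 \<beta>\<^sub>2 \<phi>" if "0 \<le> \<beta>\<^sub>1" "\<beta>\<^sub>1 < \<beta>\<^sub>2" "\<beta>\<^sub>2 \<le> \<beta>\<^sub>0" for \<beta>\<^sub>1 \<beta>\<^sub>2 \<phi>
    using that by (intro no_consistent_tests[OF assms(2,4,5)]) auto
  moreover have "\<not> consistent_estimators J {0..\<beta>\<^sub>0} est" for est
    using consistent_tests_of_estimators[of 0 \<beta>\<^sub>0 "{0..\<beta>\<^sub>0}" J est] tests[of 0 \<beta>\<^sub>0] assms(4) by auto
  ultimately show ?thesis
    by blast
qed

end
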